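(* For all integers $n\geq 4$ and $p\geq 0$, $$\left(\sum_{i = 0}^{p} \binom{p}{i} B_{n+i+1}\right)\left(\sum_{\ell = 0}^{p} \binom{p}{\ell} (B_{n+\ell-1}-B_{n+\ell-2})\right)>\left(\sum_{i = 0}^{p} \binom{p}{i} B_{n+i}\right)\left(\sum_{\ell = 0}^{p} \binom{p}{\ell} (B_{n+\ell}-B_{n+\ell-1})\right).$$
   Context: For $n\ge 0$, $B_n$ denotes the $n$-th Bell number, i.e. the number of partitions of a set with $n$ elements ($B_0=B_1=1$, $B_2=2$, $B_3=5$, $B_4=15$, ...). *)

theory Defs
  imports Complex_Main "HOL-Library.Disjoint_Sets"
begin

definition bell :: "nat \<Rightarrow> nat"
  where "bell n = card {P. partition_on {..<n} P}"

text \<open>The choice of the underlying set is immaterial, and the set of partitions is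
  finite, so \<^const>\<open>card\<close> really counts it.\<close>

lemma finite_partitions: "finite A \<Longrightarrow> finite {P. partition_on A P}"
  by (rule finite_subset[of _ "Pow (Pow A)"]) (auto simp: partition_on_def)

lemma card_partitions_eq_bell:
  assumes "finite A"
  shows "card {P. partition_on A P} = bell (card A)"
proof -
  have le: "card {P. partition_on X P} \<le> card {P. partition_on Y P}"
    if f: "bij_betw f X Y" and "finite Y" for f :: "'x \<Rightarrow> 'y" and X Y
  proof (rule card_inj_on_le)
    show "inj_on (\<lambda>P. (`) f ` P) {P. partition_on X P}"
    proof (rule inj_onI)
      fix P Q
      assume "P \<in> {P. partition_on X P}" "Q \<in> {P. partition_on X P}"
        and eq: "(`) f ` P = (`) f ` Q"
      then have "P \<subseteq> Pow X" "Q \<subseteq> Pow X"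
        by (auto simp: partition_on_def)
      moreover have "inj_on ((`) f) (Pow X)"
        using f by (simp add: bij_betw_def inj_on_image_Pow)
      ultimately show "P = Q"
        using eq by (meson inj_on_image_eq_iff)
    qed
    show "(\<lambda>P. (`) f ` P) ` {P. partition_on X P} \<subseteq> {P. partition_on Y P}"
    proof safe
      fix P
      assume P: "partition_on X P"
      have "inj_on f (\<Union>P)"
        using f P by (simp add: bij_betw_def partition_on_def)
      then have "disjoint ((`) f ` P)"
        using P by (auto simp: partition_on_def intro: disjoint_image)
      moreover have "\<Union>((`) f ` P) = Y"
        using f P by (simp add: bij_betw_def partition_on_def flip: image_Union)
      moreover have "{} \<notin> (`) f ` P"
        using P by (auto simp: partition_on_def)
      ultimately show "partition_on Y ((`) f ` P)"
        by (simp add: partition_on_def)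
    qed
    show "finite {P. partition_on Y P}"
      using \<open>finite Y\<close> by (rule finite_partitions)
  qed
  obtain f where f: "bij_betw f A {..<card A}"
    using ex_bij_betw_finite_nat[OF assms] by (auto simp: atLeast0LessThan)
  show ?thesis
    unfolding bell_def
    using le[OF f] le[OF bij_betw_inv_into[OF f] assms] by simp
qed

end

theory Submission
  imports Defs
begin

text \<open>Up to the factor \<open>exp 1\<close>, Dobinski's formula turns the four sums into moments of the
  weight \<open>w x = x ^ m * (1 + x) ^ p / fact x\<close> with \<open>m = n - 2\<close>. Writing \<open>M j\<close> for the sum of
  \<open>w x * x ^ j\<close> over all \<open>x\<close>, the claim becomes \<open>M 3 * (M 1 - M 0) > M 2 * (M 2 - M 1)\<close>.
  Put \<open>a = (M 2 - M 1) / (M 1 - M 0)\<close>, so that \<open>w x * (x - 1) * (x - a)\<close> sums to \<open>0\<close>. Since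
  \<open>(x - a)\<^sup>2 * (a * x - x - a) = (a - 1) * x\<^sup>2 * (x - a) - a\<^sup>2 * (x - 1) * (x - a)\<close>,
  the claim \<open>M 3 > a * M 2\<close> amounts to the positivity of the weighted sum of the left-hand side.
  As \<open>a \<ge> 3\<close>, only the term for \<open>x = 1\<close> is negative there, and the terms for \<open>x = 2\<close> and
  \<open>x = 4\<close> outweigh it.\<close>

lemma partition_on_minus_block:
  assumes "partition_on A P" "X \<in> P"
  shows "partition_on (A - X) (P - {X})"
proof -
  have "disjnt X (\<Union>(P - {X}))"
    using assms by (auto simp: partition_on_def pairwise_def disjnt_iff)
  moreover have "insert X (P - {X}) = P"
    using assms(2) by blast
  ultimately show ?thesis
    using partition_on_insert[of X "P - {X}" A] assms(1) by simp
qed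

text \<open>A partition of \<open>insert a A\<close> is split at the block containing
  \<open>a\<close>: \<open>C\<close> is the union of the other blocks and \<open>Q\<close> the
  partition of \<open>C\<close> that they form. Counting the pairs by the size of \<open>C\<close>
  gives the Bell recurrence.\<close>

lemma bij_betw_insert_block:
  assumes "a \<notin> A"
  shows "bij_betw (\<lambda>(C, Q). insert (insert a A - C) Q)
           (SIGMA C:Pow A. {Q. partition_on C Q}) {P. partition_on (insert a A) P}"
    (is "bij_betw ?f ?S ?T")
proof (rule bij_betw_imageI)
  show "inj_on ?f ?S"
  proof (rule inj_onI, clarify)
    fix C Q D R
    assume C: "C \<subseteq> A" and D: "D \<subseteq> A" and Q: "partition_on C Q" and R: "partition_on D R"
      and eq: "insert (insert a A - C) Q = insert (insert a A - D) R"
    \<comment> \<open>The inserted block is the only one containing \<open>a\<close>, so it can be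
      recovered from the image.\<close>
    have nin: "X \<notin> Q" "X \<notin> R" if "a \<in> X" for X
      using that C D Q R assms by (auto simp: partition_on_def)
    have "insert a A - C \<in> insert (insert a A - D) R"
      using eq by blast
    then have blocks: "insert a A - C = insert a A - D"
      using nin(2)[of "insert a A - C"] C assms by blast
    then have "C = D"
      using C D assms by blast
    moreover have "Q = R"
      using eq blocks nin(1)[of "insert a A - C"] nin(2)[of "insert a A - D"] C D assms
      by (metis DiffI insertI1 insert_ident subsetD)
    ultimately show "C = D \<and> Q = R" ..
  qed
  show "?f ` ?S = ?T"
  proof (rule antisym; rule subsetI)
    fix P assume "P \<in> ?f ` ?S"
    then obtain C Q where CQ: "C \<subseteq> A" "partition_on C Q" "P = insert (insert a A - C) Q"
      by auto
    have "disjnt (insert a A - C) (\<Union>Q)" and "insert a A - (insert a A - C) = C"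
      using CQ(1) partition_onD1[OF CQ(2)] by (auto simp: disjnt_iff)
    then show "P \<in> ?T"
      using CQ assms by (auto simp: partition_on_insert)
  next
    fix P assume "P \<in> ?T"
    then have P: "partition_on (insert a A) P" by simp
    then obtain X where X: "X \<in> P" "a \<in> X"
      by (auto simp: partition_on_def)
    let ?C = "insert a A - X"
    have sub: "X \<subseteq> insert a A"
      using P X by (auto simp: partition_on_def)
    have "partition_on ?C (P - {X})"
      using P X(1) by (rule partition_on_minus_block)
    moreover have "insert a A - ?C = X"
      using sub by blast
    then have "P = ?f (?C, P - {X})"
      using X by auto
    moreover have "?C \<subseteq> A"
      using X by blast
    ultimately show "P \<in> ?f ` ?S"
      by blast
  qed
qed

lemma sum_card_Pow:
  fixes f :: "nat \<Rightarrow> 'a::semiring_1"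
  assumes "finite A"
  shows "(\<Sum>C\<in>Pow A. f (card C)) = (\<Sum>i\<le>card A. of_nat (card A choose i) * f i)"
proof -
  have "(\<Sum>C\<in>Pow A. f (card C)) = (\<Sum>i\<le>card A. \<Sum>C | C \<in> Pow A \<and> card C = i. f (card C))"
    using assms by (subst sum.group) (auto intro: card_mono)
  also have "\<dots> = (\<Sum>i\<le>card A. of_nat (card A choose i) * f i)"
    using n_subsets[OF assms] by (intro sum.cong) auto
  finally show ?thesis .
qed

lemma bell_0: "bell 0 = 1"
  by (simp add: bell_def partition_on_empty)

lemma bell_Suc: "bell (Suc n) = (\<Sum>i\<le>n. (n choose i) * bell i)"
proof -
  have "bell (Suc n) = card {P. partition_on (insert n {..<n}) P}"
    by (simp add: bell_def lessThan_Suc)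
  also have "\<dots> = card (SIGMA C:Pow {..<n}. {Q. partition_on C Q})"
    using bij_betw_same_card[OF bij_betw_insert_block[of n "{..<n}"]] by simp
  also have "\<dots> = (\<Sum>C\<in>Pow {..<n}. card {Q. partition_on C Q})"
    by (subst card_SigmaI) (auto intro: finite_partitions finite_subset)
  also have "\<dots> = (\<Sum>C\<in>Pow {..<n}. bell (card C))"
    by (intro sum.cong card_partitions_eq_bell) (auto intro: finite_subset)
  also have "\<dots> = (\<Sum>i\<le>n. (n choose i) * bell i)"
    by (subst sum_card_Pow) simp_all
  finally show ?thesis .
qed

text \<open>By the Bell recurrence and the binomial theorem, the series for exponents up to
  \<open>m\<close> combine into the sum of \<open>(real k + 1) ^ m / fact k\<close>. This is the
  series for \<open>Suc m\<close> shifted by one index.\<close>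

theorem dobinski: "(\<lambda>k. real k ^ n / fact k) sums (exp 1 * real (bell n))"
proof (induction n rule: less_induct)
  case (less n)
  show ?case
  proof (cases n)
    case 0
    then show ?thesis
      using exp_converges[of "1::real"] by (simp add: bell_0 divide_inverse)
  next
    case (Suc m)
    have "(\<lambda>k. \<Sum>i\<le>m. real (m choose i) * (real k ^ i / fact k)) sums
        (\<Sum>i\<le>m. real (m choose i) * (exp 1 * real (bell i)))"
      using less.IH Suc by (intro sums_sum sums_mult) auto
    moreover have "(\<Sum>i\<le>m. real (m choose i) * (real k ^ i / fact k)) =
        real (Suc k) ^ n / fact (Suc k)" for k
    proof -
      have "(\<Sum>i\<le>m. real (m choose i) * (real k ^ i / fact k)) = (real k + 1) ^ m / fact k"
        by (simp add: binomial_ring sum_divide_distrib)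
      also have "\<dots> = real (Suc k) ^ n / fact (Suc k)"
        by (simp add: Suc add.commute[of _ 1] del: of_nat_Suc flip: of_nat_Suc)
      finally show ?thesis .
    qed
    moreover have "(\<Sum>i\<le>m. real (m choose i) * (exp 1 * real (bell i))) = exp 1 * real (bell n)"
      by (simp add: Suc bell_Suc sum_distrib_left mult_ac)
    ultimately have "(\<lambda>k. real (Suc k) ^ n / fact (Suc k)) sums (exp 1 * real (bell n))"
      by simp
    then show ?thesis
      \<comment> \<open>The term for \<open>k = 0\<close> that the shift leaves out vanishes, since
        \<open>n > 0\<close>.\<close>
      by (subst (asm) sums_Suc_iff) (simp add: Suc)
  qed
qed

lemma dobinski_binomial:
  "(\<lambda>k. real k ^ n * (1 + real k) ^ p / fact k) sums
     (exp 1 * (\<Sum>i=0..p. real (p choose i) * real (bell (n + i))))"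
proof -
  have "(\<lambda>k. \<Sum>i=0..p. real (p choose i) * (real k ^ (n + i) / fact k)) sums
      (\<Sum>i=0..p. real (p choose i) * (exp 1 * real (bell (n + i))))"
    by (intro sums_sum sums_mult dobinski)
  moreover have "(\<Sum>i=0..p. real (p choose i) * (real k ^ (n + i) / fact k)) =
      real k ^ n * (1 + real k) ^ p / fact k" for k
    by (simp add: add.commute[of 1] binomial_ring atMost_atLeast0 sum_distrib_left
        sum_divide_distrib power_add mult_ac)
  ultimately show ?thesis
    by (simp add: sum_distrib_left mult_ac)
qed

text \<open>The bound \<open>3 * w 4 \<ge> w 2\<close> yields \<open>a \<ge> 3\<close>; the bounds
  by \<open>w 1\<close> let the terms at 2 and 4 outweigh the negative one at 1.\<close>

lemma moment_inequality:
  fixes w :: "nat \<Rightarrow> real" and M :: "nat \<Rightarrow> real"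
  assumes nonneg: "\<And>x. w x \<ge> 0" and "w 0 = 0" and "w 1 > 0"
    and w2: "w 2 \<ge> 2 * w 1" and w4: "w 4 \<ge> 2 / 3 * w 1" "3 * w 4 \<ge> w 2"
    and M: "\<And>j. (\<lambda>x. w x * real x ^ j) sums M j"
  shows "M 2 * (M 2 - M 1) < M 3 * (M 1 - M 0)"
proof -
  have pos: "0 < s" if "f sums s" "\<And>x. x \<ge> 5 \<Longrightarrow> f x \<ge> 0" "0 < sum f {..<5}"
    for f :: "nat \<Rightarrow> real" and s
    using sum_le_suminf[of f "{..<5}"] that by (auto simp: sums_iff not_less)
  have lin: "(\<lambda>x. w x * (real x - 1)) sums (M 1 - M 0)"
    using sums_diff[OF M[of 1] M[of 0]] by (simp add: algebra_simps)
  have "0 < sum (\<lambda>x. w x * (real x - 1)) {..<5}"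
    using assms(2,3) w2 nonneg[of 3] nonneg[of 4] by (simp add: eval_nat_numeral)
  then have A: "0 < M 1 - M 0"
    using pos[OF lin] nonneg by simp
  \<comment> \<open>Nonnegativity of this sum is \<open>a \<ge> 3\<close>. Only \<open>x = 2\<close>
    contributes negatively, namely \<open>- w 2\<close>, and \<open>x = 4\<close> offsets it with
    \<open>3 * w 4\<close>.\<close>
  have quad: "(\<lambda>x. w x * ((real x - 1) * (real x - 3))) sums (M 2 - M 1 - 3 * (M 1 - M 0))"
    using sums_diff[OF sums_diff[OF M[of 2] M[of 1]] sums_mult[OF lin, of 3]]
    by (simp add: algebra_simps power2_eq_square)
  define a where "a = (M 2 - M 1) / (M 1 - M 0)"
  have M2: "M 2 - M 1 = a * (M 1 - M 0)"
    using A by (simp add: a_def)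
  have "0 \<le> sum (\<lambda>x. w x * ((real x - 1) * (real x - 3))) {..<5}"
    using assms(2) w4 by (simp add: eval_nat_numeral)
  also have "\<dots> \<le> M 2 - M 1 - 3 * (M 1 - M 0)"
    using sum_le_suminf[of "\<lambda>x. w x * ((real x - 1) * (real x - 3))" "{..<5}"] quad nonneg
    by (auto simp: sums_iff not_less)
  finally have a: "a \<ge> 3"
    using A by (simp add: a_def field_simps)
  let ?K = "\<lambda>x. w x * ((real x - a)\<^sup>2 * (a * real x - real x - a))"
  have "?K sums ((a - 1) * (M 3 - a * M 2) - a\<^sup>2 * (M 2 - M 1 - a * (M 1 - M 0)))"
    using sums_diff[OF sums_mult[OF sums_diff[OF M[of 3] sums_mult[OF M[of 2], of a]], of "a - 1"]
        sums_mult[OF sums_diff[OF sums_diff[OF M[of 2] M[of 1]] sums_mult[OF lin, of a]], of "a\<^sup>2"]]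
    by (simp add: algebra_simps power2_eq_square power3_eq_cube)
  then have K_sums: "?K sums ((a - 1) * (M 3 - a * M 2))"
    unfolding M2 by simp
  have K_nonneg: "?K x \<ge> 0" if "x \<ge> 2" for x
  proof -
    \<comment> \<open>The cubic's linear factor \<open>a * x - x - a\<close> equals
      \<open>(x - 1) * (a - 1) - 1\<close>.\<close>
    have "1 * 2 \<le> (real x - 1) * (a - 1)"
      using that a by (intro mult_mono) auto
    then have "a * real x - real x - a \<ge> 0"
      by (simp add: algebra_simps)
    then show ?thesis
      using nonneg by simp
  qed
  have K_pos: "0 < sum ?K {..<5}"
  proof -
    \<comment> \<open>The linear factor takes the values \<open>-1\<close>, \<open>a - 2\<close> and
      \<open>3 * a - 4\<close> at 1, 2 and 4.\<close>
    have K1: "- (w 1 * (a - 1)\<^sup>2) \<le> ?K 1"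
      by (simp add: power2_eq_square algebra_simps)
    have K2: "2 * w 1 * (a - 2) ^ 3 \<le> ?K 2"
    proof -
      have "2 * w 1 * (a - 2) ^ 3 \<le> w 2 * (a - 2) ^ 3"
        using mult_right_mono[OF w2, of "(a - 2) ^ 3"] a by simp
      also have "\<dots> = ?K 2"
        by (simp add: power2_eq_square power3_eq_cube algebra_simps)
      finally show ?thesis .
    qed
    have K4: "2 / 3 * w 1 * ((a - 4)\<^sup>2 * (3 * a - 4)) \<le> ?K 4"
      using mult_right_mono[OF w4(1), of "(a - 4)\<^sup>2 * (3 * a - 4)"] a
      by (simp add: power2_commute[of a 4])
    have K3: "0 \<le> ?K 3"
      by (rule K_nonneg) simp
    have "w 1 * (a - 1)\<^sup>2 <
        2 * w 1 * (a - 2) ^ 3 + 2 / 3 * w 1 * ((a - 4)\<^sup>2 * (3 * a - 4))"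
    proof -
      \<comment> \<open>With \<open>b \<ge> 0\<close> the only negative coefficient is that of
        \<open>b\<close>, and completing a square absorbs it.\<close>
      define b where "b = a - 3"
      have "2 * (a - 2) ^ 3 + 2 / 3 * ((a - 4)\<^sup>2 * (3 * a - 4)) - (a - 1)\<^sup>2 =
          4 * b ^ 3 + 13 / 3 * b\<^sup>2 - 8 / 3 * b + 4 / 3"
        unfolding b_def by (simp add: power2_eq_square power3_eq_cube field_simps)
      moreover have "\<dots> = 4 * b ^ 3 + 7 / 3 * b\<^sup>2 + 2 * (b - 2 / 3)\<^sup>2 + 4 / 9"
        by (simp add: power2_eq_square power3_eq_cube field_simps)
      moreover have "\<dots> > 0"
        using a by (simp add: b_def add_nonneg_pos)
      ultimately have "0 < w 1 * (2 * (a - 2) ^ 3 + 2 / 3 * ((a - 4)\<^sup>2 * (3 * a - 4)) - (a - 1)\<^sup>2)"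
        using assms(3) by simp
      then show ?thesis
        by (simp add: algebra_simps)
    qed
    then have "0 < - (w 1 * (a - 1)\<^sup>2) + 2 * w 1 * (a - 2) ^ 3 + 0 +
        2 / 3 * w 1 * ((a - 4)\<^sup>2 * (3 * a - 4))"
      by simp
    also have "\<dots> \<le> ?K 1 + ?K 2 + ?K 3 + ?K 4"
      by (intro add_mono K1 K2 K3 K4)
    also have "\<dots> = sum ?K {..<5}"
      using assms(2) by (simp add: lessThan_Suc eval_nat_numeral)
    finally show ?thesis .
  qed
  have "0 < (a - 1) * (M 3 - a * M 2)"
    by (rule pos[OF K_sums K_nonneg K_pos]) simp
  then have "a * M 2 < M 3"
    using a by (simp add: zero_less_mult_iff)
  then have "a * M 2 * (M 1 - M 0) < M 3 * (M 1 - M 0)"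
    using A by (rule mult_strict_right_mono)
  then show ?thesis
    unfolding M2 by (simp only: mult_ac)
qed

theorem corollary12:
  fixes n p :: nat
  assumes "n \<ge> 4"
  shows "(\<Sum>i=0..p. int (p choose i) * int (bell (n + i + 1))) *
         (\<Sum>l=0..p. int (p choose l) * (int (bell (n + l - 1)) - int (bell (n + l - 2))))
       > (\<Sum>i=0..p. int (p choose i) * int (bell (n + i))) *
         (\<Sum>l=0..p. int (p choose l) * (int (bell (n + l)) - int (bell (n + l - 1))))"
proof -
  \<comment> \<open>This shift removes the truncated subtractions: the indices become
    \<open>m + j + i\<close> with \<open>j \<le> 3\<close>.\<close>
  obtain m where n: "n = m + 2" and m: "m \<ge> 2"
    using assms that[of "n - 2"] by simp
  define S where "S j = (\<Sum>i=0..p. int (p choose i) * int (bell (m + j + i)))" for j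
  define w where "w x = real x ^ m * (1 + real x) ^ p / fact x" for x :: nat
  \<comment> \<open>The weights are \<open>w 1 = 2 ^ p\<close>,
    \<open>w 2 = 2 ^ m * 3 ^ p / 2\<close> and \<open>w 4 = 4 ^ m * 5 ^ p / 24\<close>, so
    \<open>2 ^ m \<ge> 4\<close> gives all three bounds.\<close>
  have pow: "2 ^ 2 \<le> (2::real) ^ m"
    using m by (intro power_increasing) auto
  have pow4: "(4::real) ^ m = 2 ^ m * 2 ^ m"
    by (simp flip: power_mult_distrib)
  have "exp 1 * real_of_int (S 2) * (exp 1 * real_of_int (S 2) - exp 1 * real_of_int (S 1)) <
      exp 1 * real_of_int (S 3) * (exp 1 * real_of_int (S 1) - exp 1 * real_of_int (S 0))"
  proof (rule moment_inequality[where w = w])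
    show "w 2 \<ge> 2 * w 1"
      using mult_mono[OF pow power_mono[of 2 "3::real" p]] by (simp add: w_def)
    have "4 * 4 \<le> (4::real) ^ m"
      unfolding pow4 using pow by (intro mult_mono) auto
    then show "w 4 \<ge> 2 / 3 * w 1"
      using mult_mono[of "4 * 4" "4 ^ m" "2 ^ p" "5 ^ p :: real"]
      by (simp add: w_def fact_numeral power_mono)
    have "4 * 2 ^ m \<le> (4::real) ^ m"
      unfolding pow4 using pow by (intro mult_right_mono) auto
    then show "3 * w 4 \<ge> w 2"
      using mult_mono[of "4 * 2 ^ m" "4 ^ m" "3 ^ p" "5 ^ p :: real"]
      by (simp add: w_def fact_numeral power_mono)
    show "(\<lambda>x. w x * real x ^ j) sums (exp 1 * real_of_int (S j))" for j
      using dobinski_binomial[of "m + j" p] by (simp add: w_def S_def power_add mult_ac)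
  qed (use m in \<open>auto simp: w_def\<close>)
  then have "(exp 1 * exp 1) * real_of_int (S 2 * (S 2 - S 1)) <
      (exp 1 * exp 1) * real_of_int (S 3 * (S 1 - S 0))"
    by (simp add: algebra_simps)
  then have "S 2 * (S 2 - S 1) < S 3 * (S 1 - S 0)"
    by (simp only: mult_less_cancel_left_pos exp_gt_zero mult_pos_pos of_int_less_iff)
  then show ?thesis
    by (simp add: S_def n right_diff_distrib sum_subtractf eval_nat_numeral)
qed

end
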